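(* Let $n_1 < n_2 < n_3$ be positive integers with $\gcd(n_1,n_2,n_3)=1$, let $S = \langle n_1,n_2,n_3\rangle$ be the numerical semigroup they generate, and let $$F = \frac{n_1(n_3-n_2)}{n_2(n_3-n_1)}.$$ For $n\in S$ let $\eta(n)$ be the median factorization length of $n$. Then, with the limit taken over $n \in S$, $$\lim_{n\to\infty}\frac{\eta(n)}{n} = \begin{cases} \dfrac{1}{n_1}\left(1-\sqrt{\dfrac{1-F}{2}}\right) + \dfrac{1}{n_3}\sqrt{\dfrac{1-F}{2}} & \text{if } F\le \dfrac12,\\[12pt] \dfrac{1}{n_1}\sqrt{\dfrac{F}{2}} + \dfrac{1}{n_3}\left(1-\sqrt{\dfrac{F}{2}}\right) & \text{if } F\ge \dfrac12. \end{cases}$$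
   Context: $\mathbb{N}$ denotes the nonnegative integers. $S = \langle n_1,n_2,n_3\rangle = \{a_1n_1+a_2n_2+a_3n_3 : a_1,a_2,a_3\in\mathbb{N}\}$, which has finite complement in $\mathbb{N}$. It is not assumed that $n_1,n_2,n_3$ minimally generate $S$. For $n\in S$, a factorization of $n$ is a triple $a=(a_1,a_2,a_3)\in\mathbb{N}^3$ with $n = a_1n_1+a_2n_2+a_3n_3$; its length is $|a| = a_1+a_2+a_3$. The length multiset of $n$ is the multiset of lengths of all factorizations of $n$ (each factorization contributes one entry). The median factorization length $\eta(n)$ is the median of this multiset (the middle entry when the entries are sorted with multiplicity, or the average of the two middle entries if the number of entries is even). *)

theory Defs
  imports "HOL-Analysis.Analysis" "HOL-Library.Multiset"
begin

definition semigroup3 :: "nat \<Rightarrow> nat \<Rightarrow> nat \<Rightarrow> nat set" where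
  "semigroup3 n1 n2 n3 = {a1 * n1 + a2 * n2 + a3 * n3 | a1 a2 a3. True}"

definition factorizations ::
    "nat \<Rightarrow> nat \<Rightarrow> nat \<Rightarrow> nat \<Rightarrow> (nat \<times> nat \<times> nat) set" where
  "factorizations n1 n2 n3 n = {(a1, a2, a3). n = a1 * n1 + a2 * n2 + a3 * n3}"

fun fact_length :: "nat \<times> nat \<times> nat \<Rightarrow> nat" where
  "fact_length (a1, a2, a3) = a1 + a2 + a3"

text \<open>For a finite set, \<open>mset_set\<close> contains each element exactly once; it is empty for
  infinite sets. The next lemma shows that only the finite case arises for positive generators.\<close>

definition length_multiset :: "nat \<Rightarrow> nat \<Rightarrow> nat \<Rightarrow> nat \<Rightarrow> nat multiset" where
  "length_multiset n1 n2 n3 n = image_mset fact_length (mset_set (factorizations n1 n2 n3 n))"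

lemma finite_factorizations:
  assumes "0 < n1" "0 < n2" "0 < n3"
  shows "finite (factorizations n1 n2 n3 n)"
proof (rule finite_subset)
  show "factorizations n1 n2 n3 n \<subseteq> {..n} \<times> {..n} \<times> {..n}"
  proof
    fix x assume "x \<in> factorizations n1 n2 n3 n"
    then obtain a b c where x: "x = (a, b, c)" and n: "n = a * n1 + b * n2 + c * n3"
      by (auto simp: factorizations_def)
    have "a \<le> a * n1" "b \<le> b * n2" "c \<le> c * n3" using assms by simp_all
    then have "a \<le> n" "b \<le> n" "c \<le> n" unfolding n by linarith+
    then show "x \<in> {..n} \<times> {..n} \<times> {..n}" by (simp add: x)
  qed
qed simp

text \<open>List positions are counted from \<open>0\<close>, so for \<open>k\<close> entries the middle entry is at
  position \<open>k div 2\<close> if \<open>k\<close> is odd, and the two middle entries are at positions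
  \<open>k div 2 - 1\<close> and \<open>k div 2\<close> if \<open>k\<close> is even. The value on the empty multiset
  is unspecified.\<close>

definition median :: "nat multiset \<Rightarrow> real" where
  "median M = (let xs = sorted_list_of_multiset M; k = length xs in
     if odd k then real (xs ! (k div 2))
     else (real (xs ! (k div 2 - 1)) + real (xs ! (k div 2))) / 2)"

definition median_length :: "nat \<Rightarrow> nat \<Rightarrow> nat \<Rightarrow> nat \<Rightarrow> real" where
  "median_length n1 n2 n3 n = median (length_multiset n1 n2 n3 n)"

lemma length_multiset_nonempty:
  assumes "0 < n1" "0 < n2" "0 < n3" "n \<in> semigroup3 n1 n2 n3"
  shows "length_multiset n1 n2 n3 n \<noteq> {#}"
proof -
  have "factorizations n1 n2 n3 n \<noteq> {}"
    using assms(4) by (auto simp: semigroup3_def factorizations_def)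
  then show ?thesis
    using finite_factorizations[OF assms(1-3)]
    by (simp add: length_multiset_def mset_set_empty_iff)
qed

text \<open>The limit along \<open>S\<close> is taken with respect to the filter
  \<open>inf sequentially (principal S)\<close>, which is proper for every infinite \<open>S\<close>.\<close>

lemma semigroup3_filter_nontrivial:
  assumes "0 < n1"
  shows "inf sequentially (principal (semigroup3 n1 n2 n3)) \<noteq> bot"
proof
  assume "inf sequentially (principal (semigroup3 n1 n2 n3)) = bot"
  then have "eventually (\<lambda>n. n \<notin> semigroup3 n1 n2 n3) sequentially"
    by (simp add: trivial_limit_def eventually_inf_principal)
  then obtain N where N: "\<And>n. n \<ge> N \<Longrightarrow> n \<notin> semigroup3 n1 n2 n3"
    by (auto simp: eventually_sequentially)
  have "N * n1 + 0 * n2 + 0 * n3 \<in> semigroup3 n1 n2 n3"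
    unfolding semigroup3_def by blast
  moreover have "N * n1 + 0 * n2 + 0 * n3 \<ge> N" using assms by simp
  ultimately show False using N by blast
qed

end

(* The number of lattice points of the triangle u a + v b \<le> T in the first quadrant is
   T^2 / (2 u v) + O(T + 1). Translating by vectors of bounded size permutes the residue classes of
   q a + r b modulo m transitively when gcd(q, r, m) = 1, so each class receives asymptotically a
   1/m share of these points. Dropping the first coordinate of the factorizations of n gives such a
   triangle for the set of all factorizations, and also for those of length at least x n when
   x \<ge> 1/n2; dropping the third coordinate gives one for those of length at most x n when
   x \<le> 1/n2. Hence, as n grows, the lengths divided by n follow the triangular distribution on
   [1/n3, 1/n1] with mode 1/n2, and the median is the point at which half of its mass is reached. *)
theory Submission
  imports Defs "HOL-Real_Asymp.Real_Asymp" "HOL-Number_Theory.Cong"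
begin

section \<open>Lattice points of a triangle and their residue classes\<close>

definition lattice_triangle :: "real \<Rightarrow> real \<Rightarrow> real \<Rightarrow> (nat \<times> nat) set" where
  "lattice_triangle u v T = {(a, b). u * real a + v * real b \<le> T}"

text \<open>The label \<open>k\<close> is reduced modulo \<open>m\<close>, so that any natural
  number can serve as one; later it is \<open>n\<close> itself.\<close>

definition residue_triangle ::
    "nat \<Rightarrow> nat \<Rightarrow> nat \<Rightarrow> nat \<Rightarrow> real \<Rightarrow> real \<Rightarrow> real \<Rightarrow> (nat \<times> nat) set" where
  "residue_triangle q r m k u v T =
     {(a, b) \<in> lattice_triangle u v T. (q * a + r * b) mod m = k mod m}"

lemma sum_arith_descending:
  "(\<Sum>a\<le>K. T - u * real a) = (real K + 1) * (2 * T - u * real K) / 2"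
  by (induction K) (auto simp: field_simps)

text \<open>Slicing into columns of fixed \<open>a\<close> turns the cardinality into a sum of
  floors.\<close>

lemma lattice_triangle_Sigma:
  assumes "0 < u" "0 < v" "0 \<le> T"
  shows "lattice_triangle u v T = (SIGMA a:{..nat \<lfloor>T / u\<rfloor>}. {..nat \<lfloor>(T - u * real a) / v\<rfloor>})"
proof -
  have *: "b \<le> nat \<lfloor>x\<rfloor> \<longleftrightarrow> real b \<le> x" if "0 \<le> x" for b and x :: real
    using that by (simp add: le_nat_iff le_floor_iff)
  have a: "a \<le> nat \<lfloor>T / u\<rfloor> \<longleftrightarrow> u * real a \<le> T" for a
    using assms by (subst *) (auto simp: field_simps)
  have b: "b \<le> nat \<lfloor>(T - u * real a) / v\<rfloor> \<longleftrightarrow> u * real a + v * real b \<le> T"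
    if "u * real a \<le> T" for a b
    using assms that by (subst *) (auto simp: field_simps)
  have "u * real a \<le> T" if "u * real a + v * real b \<le> T" for a b
    using that assms by (smt (verit) mult_nonneg_nonneg of_nat_0_le_iff)
  then show ?thesis
    unfolding lattice_triangle_def by (auto simp: a b)
qed

lemma finite_lattice_triangle:
  assumes "0 < u" "0 < v"
  shows "finite (lattice_triangle u v T)"
proof (cases "0 \<le> T")
  case True
  then show ?thesis using assms by (simp add: lattice_triangle_Sigma)
next
  case False
  then have "\<not> u * real a + v * real b \<le> T" for a b
    using assms by (smt (verit) mult_nonneg_nonneg of_nat_0_le_iff)
  then have "lattice_triangle u v T = {}"
    unfolding lattice_triangle_def by auto
  then show ?thesis by simp
qed

lemma finite_residue_triangle:
  assumes "0 < u" "0 < v"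
  shows "finite (residue_triangle q r m k u v T)"
  using finite_lattice_triangle[OF assms] by (rule finite_subset[rotated]) (auto simp: residue_triangle_def)

text \<open>With \<open>x = (T - u * a) / v\<close>, a column holds between \<open>x\<close> and
  \<open>x + 1\<close> points, and these bounds form arithmetic series in \<open>a\<close>. The
  factor \<open>2 * u * v\<close> stays with the count to avoid division.\<close>

lemma card_lattice_triangle_bounds:
  assumes "0 < u" "0 < v" "0 \<le> T"
  shows "T\<^sup>2 \<le> 2 * u * v * real (card (lattice_triangle u v T))"
    and "2 * u * v * real (card (lattice_triangle u v T)) \<le> (T + u + v)\<^sup>2"
proof -
  define K where "K = nat \<lfloor>T / u\<rfloor>"
  define N where "N = real (card (lattice_triangle u v T))"
  have N: "N = (\<Sum>a\<le>K. real (nat \<lfloor>(T - u * real a) / v\<rfloor>) + 1)"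
    unfolding N_def lattice_triangle_Sigma[OF assms] K_def by (simp add: add.commute)
  have fl: "real K = of_int \<lfloor>T / u\<rfloor>"
    using assms unfolding K_def by simp
  have "real K \<le> T / u" "T / u < real K + 1"
    unfolding fl by linarith+
  then have K: "u * real K \<le> T" "T < u * real K + u"
    using assms by (simp_all add: field_simps)
  have nn: "0 \<le> (T - u * real a) / v" if "a \<le> K" for a
  proof -
    have "u * real a \<le> u * real K" using that assms by simp
    then have "0 \<le> T - u * real a" using K by linarith
    then show ?thesis using assms by (intro divide_nonneg_nonneg) auto
  qed
  define S where "S = (\<Sum>a\<le>K. T - u * real a)"
  have S: "2 * S = (real K + 1) * (2 * T - u * real K)"
    unfolding S_def sum_arith_descending by simp
  have "(\<Sum>a\<le>K. (T - u * real a) / v) \<le> N"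
    unfolding N by (rule sum_mono) linarith
  then have "S / v \<le> N"
    unfolding S_def sum_divide_distrib .
  then have lo: "S \<le> v * N" using assms by (simp add: field_simps)
  have "N \<le> (\<Sum>a\<le>K. (T - u * real a) / v + 1)"
    unfolding N by (intro sum_mono) (use nn in auto)
  also have "\<dots> = S / v + (real K + 1)"
    unfolding S_def sum_divide_distrib by (simp add: sum.distrib)
  finally have hi: "v * N \<le> S + v * (real K + 1)"
    using assms by (simp add: field_simps)
  have uS: "2 * (u * S) = (u * real K + u) * (2 * T - u * real K)"
    using S by algebra
  \<comment> \<open>Since \<open>u * K <= T < u * K + u\<close>, both factors on the right are at
    least \<open>T\<close>.\<close>
  have "T * T \<le> (u * real K + u) * (2 * T - u * real K)"
    using K assms by (intro mult_mono) auto
  then have "T\<^sup>2 \<le> 2 * (u * S)" unfolding uS power2_eq_square .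
  also have "\<dots> \<le> 2 * (u * (v * N))" using lo assms by simp
  finally show "T\<^sup>2 \<le> 2 * u * v * real (card (lattice_triangle u v T))"
    unfolding N_def by (simp add: mult.assoc)
  have "u * (v * N) \<le> u * (S + v * (real K + 1))" using hi assms by simp
  then have "2 * u * v * N \<le> 2 * (u * S) + 2 * v * (u * real K + u)"
    by (simp add: algebra_simps)
  also have "\<dots> = (u * real K + u) * (2 * T - u * real K) + 2 * v * (u * real K + u)"
    unfolding uS ..
  \<comment> \<open>The same inequalities bound both factors by \<open>T + u\<close>; adding
    \<open>v^2\<close> then completes the square.\<close>
  also have "\<dots> \<le> (T + u) * (T + u) + 2 * v * (T + u)"
    using K assms by (intro add_mono mult_mono) auto
  also have "\<dots> \<le> (T + u + v)\<^sup>2"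
    by (simp add: power2_eq_square algebra_simps)
  finally show "2 * u * v * real (card (lattice_triangle u v T)) \<le> (T + u + v)\<^sup>2"
    unfolding N_def .
qed

text \<open>A Bezout combination of \<open>q\<close> and \<open>r\<close>, times an inverse of their
  gcd modulo \<open>m\<close>, represents 1 and hence every residue. Reducing the coefficients
  modulo \<open>m\<close> makes them natural numbers of bounded size.\<close>

lemma linear_form_hits_residue:
  fixes q r m s :: nat
  assumes "0 < m" "coprime (gcd q r) m"
  obtains i j where "i < m" "j < m" "(q * i + r * j) mod m = s mod m"
proof -
  obtain x y :: int where xy: "x * int q + y * int r = gcd (int q) (int r)"
    using bezout_int by blast
  have "coprime (gcd (int q) (int r)) (int m)"
    using assms by (metis coprime_int_iff gcd_int_int_eq)
  then obtain z where z: "[gcd (int q) (int r) * z = 1] (mod int m)"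
    using cong_solve_coprime_int by blast
  define i where "i = (x * z * int s) mod int m"
  define j where "j = (y * z * int s) mod int m"
  have ij: "0 \<le> i" "i < int m" "0 \<le> j" "j < int m"
    using assms unfolding i_def j_def by simp_all
  have "[int q * i + int r * j = int q * (x * z * int s) + int r * (y * z * int s)] (mod int m)"
    unfolding i_def j_def by (intro cong_add cong_mult cong_refl) (simp_all add: cong_def)
  also have "int q * (x * z * int s) + int r * (y * z * int s) = gcd (int q) (int r) * z * int s"
    unfolding xy[symmetric] by (simp add: algebra_simps)
  also have "[gcd (int q) (int r) * z * int s = 1 * int s] (mod int m)"
    using z by (rule cong_scalar_right)
  finally have "[int (q * nat i + r * nat j) = int s] (mod int m)"
    using ij by simp
  then have "(q * nat i + r * nat j) mod m = s mod m"
    unfolding cong_int_iff unfolding cong_def .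
  then show ?thesis using that[of "nat i" "nat j"] ij by auto
qed

text \<open>Translation by a suitable \<open>(i, j)\<close> maps the class of \<open>k\<close>
  injectively into that of \<open>l\<close>, and \<open>i, j < m\<close> limits the growth of
  \<open>T\<close>.\<close>

lemma card_residue_triangle_le_shift:
  assumes "0 < u" "0 < v" "0 < m" "coprime (gcd q r) m"
  shows "card (residue_triangle q r m k u v T)
    \<le> card (residue_triangle q r m l u v (T + (u + v) * real m))"
proof -
  \<comment> \<open>Modulo \<open>m\<close>, \<open>l + (m - 1) * k\<close> stands for
    \<open>l - k\<close> without truncated subtraction.\<close>
  obtain i j where ij: "i < m" "j < m" and s: "(q * i + r * j) mod m = (l + (m - 1) * k) mod m"
    using linear_form_hits_residue[OF assms(3,4)] by blast
  have le: "u * real i + v * real j \<le> (u + v) * real m"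
    using ij assms by (simp add: distrib_right add_mono)
  have "(q * (a + i) + r * (b + j)) mod m = l mod m" if "(q * a + r * b) mod m = k mod m" for a b
  proof -
    have "(q * (a + i) + r * (b + j)) mod m = ((q * a + r * b) + (q * i + r * j)) mod m"
      by (simp add: algebra_simps)
    also have "\<dots> = (k + (l + (m - 1) * k)) mod m"
      using that s by (rule mod_add_cong)
    also have "k + (l + (m - 1) * k) = l + m * k"
      using assms(3) by (cases m) auto
    finally show ?thesis by simp
  qed
  then have "(\<lambda>(a, b). (a + i, b + j)) ` residue_triangle q r m k u v T
      \<subseteq> residue_triangle q r m l u v (T + (u + v) * real m)"
    using le by (auto simp: residue_triangle_def lattice_triangle_def algebra_simps)
  moreover have "inj_on (\<lambda>(a, b). (a + i, b + j)) (residue_triangle q r m k u v T)"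
    by (auto simp: inj_on_def)
  ultimately show ?thesis
    using finite_residue_triangle[OF assms(1,2)] by (intro card_inj_on_le)
qed

lemma card_lattice_triangle_residues:
  assumes "0 < u" "0 < v" "0 < m"
  shows "card (lattice_triangle u v T) = (\<Sum>l<m. card (residue_triangle q r m l u v T))"
proof -
  have "lattice_triangle u v T = (\<Union>l<m. residue_triangle q r m l u v T)"
    using assms(3) by (force simp: residue_triangle_def)
  also have "card \<dots> = (\<Sum>l<m. card (residue_triangle q r m l u v T))"
    by (intro card_UN_disjoint ballI finite_residue_triangle assms) (auto simp: residue_triangle_def)
  finally show ?thesis .
qed

text \<open>One class is compared with each of the \<open>m\<close> classes of the enlarged or the
  shrunken triangle, and the comparisons are summed.\<close>

lemma card_residue_triangle_bounds:
  assumes "0 < u" "0 < v" "0 < m" "coprime (gcd q r) m"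
  shows "m * card (residue_triangle q r m k u v T) \<le> card (lattice_triangle u v (T + (u + v) * real m))"
    and "card (lattice_triangle u v (T - (u + v) * real m)) \<le> m * card (residue_triangle q r m k u v T)"
proof -
  have "m * card (residue_triangle q r m k u v T) = (\<Sum>l<m. card (residue_triangle q r m k u v T))"
    by simp
  also have "\<dots> \<le> card (lattice_triangle u v (T + (u + v) * real m))"
    unfolding card_lattice_triangle_residues[OF assms(1-3), where q = q and r = r]
    by (intro sum_mono card_residue_triangle_le_shift assms)
  finally show "m * card (residue_triangle q r m k u v T)
    \<le> card (lattice_triangle u v (T + (u + v) * real m))" .
  have "card (lattice_triangle u v (T - (u + v) * real m)) \<le> (\<Sum>l<m. card (residue_triangle q r m k u v T))"
    unfolding card_lattice_triangle_residues[OF assms(1-3), where q = q and r = r]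
    using card_residue_triangle_le_shift[OF assms, where T = "T - (u + v) * real m" and l = k]
    by (intro sum_mono) auto
  then show "card (lattice_triangle u v (T - (u + v) * real m))
    \<le> m * card (residue_triangle q r m k u v T)" by simp
qed

section \<open>Asymptotic counts of solutions of a linear equation\<close>

text \<open>The shift by \<open>C\<close> alters the quadratic bounds only in lower order terms. The
  class moves with \<open>n\<close>, but the bounds are uniform in it.\<close>

lemma residue_triangle_asymp:
  assumes "0 < u" "0 < v" "0 < m" "coprime (gcd q r) m" "0 < \<alpha>"
  shows "(\<lambda>n. real (card (residue_triangle q r m n u v (\<alpha> * real n))) / (real n)\<^sup>2)
    \<longlonglongrightarrow> \<alpha>\<^sup>2 / (2 * u * v * real m)"
proof -
  define C where "C = (u + v) * real m"
  define N where "N n = real (card (residue_triangle q r m n u v (\<alpha> * real n)))" for n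
  define c where "c = 2 * u * v * real m"
  have c: "0 < c" using assms unfolding c_def by simp
  have C: "0 \<le> C" using assms unfolding C_def by simp
  have bounds: "(\<alpha> * real n - C)\<^sup>2 \<le> c * N n" "c * N n \<le> (\<alpha> * real n + C + u + v)\<^sup>2"
    if n: "C \<le> \<alpha> * real n" for n
  proof -
    have "(\<alpha> * real n - C)\<^sup>2 \<le> 2 * u * v * real (card (lattice_triangle u v (\<alpha> * real n - C)))"
      using n assms by (intro card_lattice_triangle_bounds) auto
    also have "\<dots> \<le> 2 * u * v * real (m * card (residue_triangle q r m n u v (\<alpha> * real n)))"
      using card_residue_triangle_bounds(2)[OF assms(1-4)] assms unfolding C_def
      by (intro mult_left_mono) (auto simp del: of_nat_mult)
    finally show "(\<alpha> * real n - C)\<^sup>2 \<le> c * N n"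
      unfolding c_def N_def by (simp add: mult.assoc)
    have "c * N n = 2 * u * v * real (m * card (residue_triangle q r m n u v (\<alpha> * real n)))"
      unfolding c_def N_def by (simp add: mult.assoc)
    also have "\<dots> \<le> 2 * u * v * real (card (lattice_triangle u v (\<alpha> * real n + C)))"
      using card_residue_triangle_bounds(1)[OF assms(1-4)] assms unfolding C_def
      by (intro mult_left_mono) (auto simp del: of_nat_mult)
    also have "\<dots> \<le> (\<alpha> * real n + C + u + v)\<^sup>2"
      using n assms C by (intro card_lattice_triangle_bounds) auto
    finally show "c * N n \<le> (\<alpha> * real n + C + u + v)\<^sup>2" .
  qed
  have large: "eventually (\<lambda>n. C \<le> \<alpha> * real n) sequentially"
    using assms(5) by real_asymp
  have "(\<lambda>n. N n / (real n)\<^sup>2) \<longlonglongrightarrow> \<alpha>\<^sup>2 / c"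
  proof (rule tendsto_sandwich)
    show "eventually (\<lambda>n. (\<alpha> * real n - C)\<^sup>2 / c / (real n)\<^sup>2 \<le> N n / (real n)\<^sup>2) sequentially"
      using large
      by eventually_elim
        (intro divide_right_mono, use bounds c in \<open>simp_all add: pos_divide_le_eq pos_le_divide_eq mult.commute\<close>)
    show "eventually (\<lambda>n. N n / (real n)\<^sup>2 \<le> (\<alpha> * real n + C + u + v)\<^sup>2 / c / (real n)\<^sup>2) sequentially"
      using large
      by eventually_elim
        (intro divide_right_mono, use bounds c in \<open>simp_all add: pos_divide_le_eq pos_le_divide_eq mult.commute\<close>)
    show "(\<lambda>n. (\<alpha> * real n - C)\<^sup>2 / c / (real n)\<^sup>2) \<longlonglongrightarrow> \<alpha>\<^sup>2 / c"
      using assms(5) c by (real_asymp simp: power2_eq_square field_simps)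
    show "(\<lambda>n. (\<alpha> * real n + C + u + v)\<^sup>2 / c / (real n)\<^sup>2) \<longlonglongrightarrow> \<alpha>\<^sup>2 / c"
      using assms(5) c by (real_asymp simp: power2_eq_square field_simps)
  qed
  then show ?thesis unfolding N_def c_def .
qed

text \<open>The last two hypotheses put the triangle inside the region \<open>a q + b r \<le> n\<close>, so that
  the third coordinate \<open>c\<close> is automatically nonnegative.\<close>

lemma solutions_asymp:
  fixes p q r :: nat
  assumes "0 < u" "0 < v" "0 < p" "coprime (gcd q r) p" "0 < \<alpha>"
    and "\<alpha> * real q \<le> u" "\<alpha> * real r \<le> v"
  shows "(\<lambda>n. real (card {(c, a, b). n = c * p + a * q + b * r \<and> u * real a + v * real b \<le> \<alpha> * real n})
      / (real n)\<^sup>2) \<longlonglongrightarrow> \<alpha>\<^sup>2 / (2 * u * v * real p)"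
proof -
  have "card {(c, a, b). n = c * p + a * q + b * r \<and> u * real a + v * real b \<le> \<alpha> * real n}
      = card (residue_triangle q r p n u v (\<alpha> * real n))" (is "card ?A = card ?B") for n
  proof (rule bij_betw_same_card, rule bij_betw_imageI)
    \<comment> \<open>As \<open>0 < p\<close>, the coordinate \<open>c\<close> is determined by the
      other two.\<close>
    show "inj_on snd ?A" using assms(3) by (auto simp: inj_on_def)
    have "(a, b) \<in> snd ` ?A" if ab: "(a, b) \<in> ?B" for a b
    proof -
      have le: "u * real a + v * real b \<le> \<alpha> * real n"
        and md: "(q * a + r * b) mod p = n mod p"
        using ab by (auto simp: residue_triangle_def lattice_triangle_def)
      have "\<alpha> * real q * real a + \<alpha> * real r * real b \<le> u * real a + v * real b"
        using assms by (intro add_mono mult_right_mono) auto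
      then have "\<alpha> * real (q * a + r * b) \<le> \<alpha> * real n"
        using le by (simp add: algebra_simps)
      then have "q * a + r * b \<le> n" using assms(5) by (simp del: of_nat_add of_nat_mult)
      moreover from this have "p dvd n - (q * a + r * b)"
        using md by (metis mod_eq_dvd_iff_nat)
      ultimately obtain c where "n = c * p + a * q + b * r"
        by (metis dvd_def le_add_diff_inverse2 mult.commute add.assoc)
      then show ?thesis using le by force
    qed
    moreover have "snd ` ?A \<subseteq> ?B"
      by (auto simp: residue_triangle_def lattice_triangle_def algebra_simps mod_simps)
    ultimately show "snd ` ?A = ?B" by auto
  qed
  then show ?thesis using residue_triangle_asymp[OF assms(1-5)] by simp
qed

section \<open>Medians and limits of quotients\<close>

lemma median_ge:
  assumes "2 * size {#x \<in># M. real x < t#} < size M"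
  shows "t \<le> median M"
proof -
  define xs where "xs = sorted_list_of_multiset M"
  have srt: "sorted xs" and M: "M = mset xs" by (simp_all add: xs_def)
  have cnt: "2 * card {j. j < length xs \<and> real (xs ! j) < t} < length xs"
    using assms unfolding M by (simp add: mset_filter[symmetric] length_filter_conv_card del: mset_filter)
  \<comment> \<open>If entry \<open>i\<close> were below \<open>t\<close>, so would be all
    \<open>i + 1\<close> entries up to it, which is at least half of the list.\<close>
  have ge: "t \<le> real (xs ! i)" if "i < length xs" "length xs \<le> 2 * (i + 1)" for i
  proof (rule ccontr)
    assume "\<not> t \<le> real (xs ! i)"
    then have "{..i} \<subseteq> {j. j < length xs \<and> real (xs ! j) < t}"
      using that sorted_nth_mono[OF srt] by (fastforce dest: le_less_trans[OF of_nat_mono])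
    then have "card {..i} \<le> card {j. j < length xs \<and> real (xs ! j) < t}"
      by (intro card_mono) auto
    then show False using cnt that by simp
  qed
  have "t \<le> real (xs ! (length xs div 2))"
    using cnt by (intro ge) auto
  \<comment> \<open>For even length, \<open>length xs <= 2 * (i + 1)\<close> is an equality at this
    position; for odd length the median does not involve it.\<close>
  moreover have "t \<le> real (xs ! (length xs div 2 - 1))" if "even (length xs)"
    using cnt that by (intro ge) auto
  ultimately show ?thesis
    unfolding median_def Let_def xs_def[symmetric] by auto
qed

text \<open>Mirror image, with the \<open>length xs - i\<close> entries from \<open>i\<close>
  onwards. A smaller \<open>i\<close> leaves more of them, so both positions qualify for either
  parity.\<close>

lemma median_le:
  assumes "2 * size {#x \<in># M. t < real x#} < size M"
  shows "median M \<le> t"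
proof -
  define xs where "xs = sorted_list_of_multiset M"
  have srt: "sorted xs" and M: "M = mset xs" by (simp_all add: xs_def)
  have cnt: "2 * card {j. j < length xs \<and> t < real (xs ! j)} < length xs"
    using assms unfolding M by (simp add: mset_filter[symmetric] length_filter_conv_card del: mset_filter)
  have le: "real (xs ! i) \<le> t" if "i < length xs" "length xs \<le> 2 * (length xs - i)" for i
  proof (rule ccontr)
    assume "\<not> real (xs ! i) \<le> t"
    then have "{i..<length xs} \<subseteq> {j. j < length xs \<and> t < real (xs ! j)}"
      using that sorted_nth_mono[OF srt] by (fastforce dest: less_le_trans[OF _ of_nat_mono])
    then have "card {i..<length xs} \<le> card {j. j < length xs \<and> t < real (xs ! j)}"
      by (intro card_mono) auto
    then show False using cnt that by simp
  qed
  have "real (xs ! (length xs div 2)) \<le> t"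
    using cnt by (intro le) auto
  moreover have "real (xs ! (length xs div 2 - 1)) \<le> t"
    using cnt by (intro le) auto
  ultimately show ?thesis
    unfolding median_def Let_def xs_def[symmetric] by auto
qed

text \<open>A number strictly between the limits separates the quotients.\<close>

lemma eventually_less_of_ratio_limits:
  fixes f g h :: "nat \<Rightarrow> real"
  assumes "(\<lambda>n. f n / h n) \<longlonglongrightarrow> a" "(\<lambda>n. g n / h n) \<longlonglongrightarrow> b" "a < b" "\<And>n. 0 \<le> h n"
  shows "eventually (\<lambda>n. f n < g n) sequentially"
proof -
  obtain c where c: "a < c" "c < b" using dense[OF assms(3)] by blast
  have "eventually (\<lambda>n. f n / h n < c) sequentially" "eventually (\<lambda>n. c < g n / h n) sequentially"
    using order_tendstoD[OF assms(1)] order_tendstoD[OF assms(2)] c by auto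
  then show ?thesis
  proof eventually_elim
    case (elim n)
    then have "f n / h n < g n / h n" by simp
    \<comment> \<open>Division by zero yields 0, so \<open>h n = 0\<close> contradicts the strict
      inequality of the quotients.\<close>
    then show ?case
      using assms(4)[of n] by (cases "h n = 0") (auto simp: divide_less_cancel)
  qed
qed

text \<open>Slopes are confined to an interval around \<open>L\<close>, because the counts that
  supply the bounds are known only for slopes in certain ranges.\<close>

lemma tendsto_ratio_of_linear_bounds:
  fixes f :: "nat \<Rightarrow> real"
  assumes "l < L" "L < u"
    and lo: "\<And>x. l < x \<Longrightarrow> x < L \<Longrightarrow> eventually (\<lambda>n. x * real n \<le> f n) sequentially"
    and hi: "\<And>x. L < x \<Longrightarrow> x < u \<Longrightarrow> eventually (\<lambda>n. f n \<le> x * real n) sequentially"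
  shows "(\<lambda>n. f n / real n) \<longlonglongrightarrow> L"
proof (rule order_tendstoI)
  fix y assume "y < L"
  then obtain x where x: "max l y < x" "x < L" using dense[of "max l y" L] assms(1) by auto
  then have "eventually (\<lambda>n. x * real n \<le> f n) sequentially" by (intro lo) auto
  then show "eventually (\<lambda>n. y < f n / real n) sequentially"
    using eventually_gt_at_top[of 0]
  proof eventually_elim
    case (elim n)
    then have "x \<le> f n / real n" by (simp add: field_simps)
    then show ?case using x by simp
  qed
next
  fix y assume "L < y"
  then obtain x where x: "L < x" "x < min u y" using dense[of L "min u y"] assms(2) by auto
  then have "eventually (\<lambda>n. f n \<le> x * real n) sequentially" by (intro hi) auto
  then show "eventually (\<lambda>n. f n / real n < y) sequentially"
    using eventually_gt_at_top[of 0]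
  proof eventually_elim
    case (elim n)
    then have "f n / real n \<le> x" by (simp add: field_simps)
    then show ?case using x by simp
  qed
qed

section \<open>All, long and short factorizations\<close>

locale three_generators =
  fixes n1 n2 n3 :: nat
  assumes pos: "0 < n1" and less12: "n1 < n2" and less23: "n2 < n3"
    and Gcd1: "Gcd {n1, n2, n3} = 1"
begin

abbreviation Z :: "nat \<Rightarrow> (nat \<times> nat \<times> nat) set" where
  "Z n \<equiv> factorizations n1 n2 n3 n"

lemma finite_Z: "finite (Z n)"
  using pos less12 less23 by (intro finite_factorizations) auto

lemma size_filter_length_multiset:
  "size {#k \<in># length_multiset n1 n2 n3 n. P k#} = card {z \<in> Z n. P (fact_length z)}"
  unfolding length_multiset_def
  by (simp add: filter_mset_image_mset finite_Z)

lemma size_length_multiset: "size (length_multiset n1 n2 n3 n) = card (Z n)"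
  unfolding length_multiset_def by simp

lemma median_length_ge:
  assumes "2 * card {z \<in> Z n. real (fact_length z) < t} < card (Z n)"
  shows "t \<le> median_length n1 n2 n3 n"
  unfolding median_length_def using assms
  by (intro median_ge) (simp add: size_filter_length_multiset size_length_multiset)

lemma median_length_le:
  assumes "2 * card {z \<in> Z n. t < real (fact_length z)} < card (Z n)"
  shows "median_length n1 n2 n3 n \<le> t"
  unfolding median_length_def using assms
  by (intro median_le) (simp add: size_filter_length_multiset size_length_multiset)

lemma card_split:
  "card (Z n) = card {z \<in> Z n. P z} + card {z \<in> Z n. \<not> P z}"
proof -
  have "Z n = {z \<in> Z n. P z} \<union> {z \<in> Z n. \<not> P z}" by auto
  then have "card (Z n) = card ({z \<in> Z n. P z} \<union> {z \<in> Z n. \<not> P z})" by simp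
  also have "\<dots> = card {z \<in> Z n. P z} + card {z \<in> Z n. \<not> P z}"
    using finite_Z by (intro card_Un_disjoint) auto
  finally show ?thesis .
qed

text \<open>The form in which the gcd hypothesis enters the residue counts: modulo \<open>n1\<close>
  when the first coordinate is dropped, modulo \<open>n3\<close> when the third is.\<close>

lemma coprime1: "coprime (gcd n2 n3) n1" and coprime3: "coprime (gcd n1 n2) n3"
  using Gcd1 by (simp_all add: coprime_iff_gcd_eq_1 ac_simps gcd.assoc)

lemma total_asymp:
  "(\<lambda>n. real (card (Z n)) / (real n)\<^sup>2) \<longlonglongrightarrow> 1 / (2 * real n1 * real n2 * real n3)"
proof -
  \<comment> \<open>With \<open>\<alpha> = 1\<close> the inequality only says that the first
    coordinate is nonnegative.\<close>
  have "{(c, a, b). n = c * n1 + a * n2 + b * n3 \<and> real n2 * real a + real n3 * real b \<le> 1 * real n} = Z n" for n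
    unfolding factorizations_def by (auto simp: algebra_simps)
  moreover have "(\<lambda>n. real (card {(c, a, b). n = c * n1 + a * n2 + b * n3
      \<and> real n2 * real a + real n3 * real b \<le> 1 * real n}) / (real n)\<^sup>2)
      \<longlonglongrightarrow> 1\<^sup>2 / (2 * real n2 * real n3 * real n1)"
    using pos less12 less23 coprime1 by (intro solutions_asymp) auto
  ultimately show ?thesis by (simp add: ac_simps)
qed

text \<open>Eliminating the first coordinate gives
  \<open>n1 * length = n - (n2 - n1) * a - (n3 - n1) * b\<close>, so long factorizations fill a
  triangle.\<close>

lemma long_asymp:
  assumes "1 / real n2 \<le> x" "x < 1 / real n1"
  shows "(\<lambda>n. real (card {z \<in> Z n. x * real n \<le> real (fact_length z)}) / (real n)\<^sup>2)
    \<longlonglongrightarrow> (1 - x * real n1)\<^sup>2 / (2 * (real n2 - real n1) * (real n3 - real n1) * real n1)"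
proof -
  have "0 < 1 / real n2" using less12 by simp
  then have "0 < x" using assms(1) by (rule less_le_trans)
  then have x: "x * real n1 < 1" "1 \<le> x * real n2" "0 < x"
    using assms pos less12 by (auto simp: field_simps)
  have "x * real n2 \<le> x * real n3" using x less23 by simp
  then have x3: "1 \<le> x * real n3" using x by linarith
  have eq: "{z \<in> Z n. x * real n \<le> real (fact_length z)} =
    {(c, a, b). n = c * n1 + a * n2 + b * n3 \<and>
      (real n2 - real n1) * real a + (real n3 - real n1) * real b \<le> (1 - x * real n1) * real n}" for n
  proof -
    have "x * real n \<le> real (c + a + b) \<longleftrightarrow>
        (real n2 - real n1) * real a + (real n3 - real n1) * real b \<le> (1 - x * real n1) * real n"
      if n: "n = c * n1 + a * n2 + b * n3" for a b c
    proof -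
      have "x * real n \<le> real (c + a + b) \<longleftrightarrow> real n1 * (x * real n) \<le> real n1 * real (c + a + b)"
        using pos by simp
      moreover have "real n = real c * real n1 + real a * real n2 + real b * real n3"
        unfolding n by simp
      ultimately show ?thesis by (simp add: algebra_simps)
    qed
    then show ?thesis unfolding factorizations_def by auto
  qed
  \<comment> \<open>The containment conditions of \<open>solutions_asymp\<close> reduce to
    \<open>1 <= x * n2\<close> and \<open>1 <= x * n3\<close>.\<close>
  show ?thesis unfolding eq
    using pos less12 less23 coprime1 x x3
    by (intro solutions_asymp) (auto simp: algebra_simps)
qed

text \<open>Eliminating the third coordinate gives
  \<open>n3 * length = n + (n3 - n1) * a + (n3 - n2) * b\<close>, so short factorizations fill a
  triangle.\<close>

lemma short_asymp:
  assumes "1 / real n3 < x" "x \<le> 1 / real n2"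
  shows "(\<lambda>n. real (card {z \<in> Z n. real (fact_length z) \<le> x * real n}) / (real n)\<^sup>2)
    \<longlonglongrightarrow> (x * real n3 - 1)\<^sup>2 / (2 * (real n3 - real n1) * (real n3 - real n2) * real n3)"
proof -
  have "0 < 1 / real n3" using less23 by simp
  then have "0 < x" using assms(1) by (rule less_trans)
  then have x: "1 < x * real n3" "x * real n2 \<le> 1" "0 < x"
    using assms less12 less23 by (auto simp: field_simps)
  have "x * real n1 \<le> x * real n2" using x less12 by simp
  then have x1: "x * real n1 \<le> 1" using x by linarith
  let ?A = "\<lambda>n. {(c, a, b). n = c * n3 + a * n1 + b * n2 \<and>
      (real n3 - real n1) * real a + (real n3 - real n2) * real b \<le> (x * real n3 - 1) * real n}"
  have card_eq: "card {z \<in> Z n. real (fact_length z) \<le> x * real n} = card (?A n)" for n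
  proof (rule bij_betw_same_card)
    have "real (a + b + c) \<le> x * real n \<longleftrightarrow>
        (real n3 - real n1) * real a + (real n3 - real n2) * real b \<le> (x * real n3 - 1) * real n"
      if n: "n = a * n1 + b * n2 + c * n3" for a b c
    proof -
      have "real (a + b + c) \<le> x * real n \<longleftrightarrow> real n3 * real (a + b + c) \<le> real n3 * (x * real n)"
        using less23 by simp
      moreover have "real n = real c * real n3 + real a * real n1 + real b * real n2"
        unfolding n by simp
      ultimately show ?thesis by (simp add: algebra_simps)
    qed
    then have "{z \<in> Z n. real (fact_length z) \<le> x * real n} = {(a, b, c). n = a * n1 + b * n2 + c * n3 \<and>
        (real n3 - real n1) * real a + (real n3 - real n2) * real b \<le> (x * real n3 - 1) * real n}"
      unfolding factorizations_def by auto
    then show "bij_betw (\<lambda>(a, b, c). (c, a, b)) {z \<in> Z n. real (fact_length z) \<le> x * real n} (?A n)"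
      by (simp only:) (intro bij_betw_byWitness[where f' = "\<lambda>(c, a, b). (a, b, c)"], auto simp: ac_simps)
  qed
  \<comment> \<open>Here the containment conditions reduce to \<open>x * n1 <= 1\<close> and
    \<open>x * n2 <= 1\<close>.\<close>
  show ?thesis unfolding card_eq
    using pos less12 less23 coprime3 x x1
    by (intro solutions_asymp) (auto simp: algebra_simps)
qed

section \<open>Locating the median by long and short counts\<close>

abbreviation half_count :: real where
  "half_count \<equiv> 1 / (2 * real n1 * real n2 * real n3) / 2"

text \<open>A limiting tail count over \<open>n^2\<close>, not a probability density; it counts
  lengths at least \<open>x * n\<close> when \<open>1 / n2 <= x < 1 / n1\<close>.\<close>

abbreviation long_density :: "real \<Rightarrow> real" where
  "long_density x \<equiv> (1 - x * real n1)\<^sup>2 / (2 * (real n2 - real n1) * (real n3 - real n1) * real n1)"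

text \<open>The counterpart for lengths at most \<open>x * n\<close>, when
  \<open>1 / n3 < x <= 1 / n2\<close>.\<close>

abbreviation short_density :: "real \<Rightarrow> real" where
  "short_density x \<equiv> (x * real n3 - 1)\<^sup>2 / (2 * (real n3 - real n1) * (real n3 - real n2) * real n3)"

lemma half_asymp: "(\<lambda>n. real (card (Z n)) / 2 / (real n)\<^sup>2) \<longlonglongrightarrow> half_count"
  using tendsto_divide[OF total_asymp tendsto_const[of 2]] by (simp add: field_simps)

text \<open>\<open>long_density\<close> decreases up to \<open>1 / n1\<close>, so beyond
  \<open>L\<close> fewer than half of the factorizations are that long.\<close>

lemma median_le_of_long:
  assumes "long_density L = half_count" "1 / real n2 \<le> L" "L < x" "x < 1 / real n1"
  shows "eventually (\<lambda>n. median_length n1 n2 n3 n \<le> x * real n) sequentially"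
proof -
  have "(1 - x * real n1)\<^sup>2 < (1 - L * real n1)\<^sup>2"
    using assms pos by (intro power_strict_mono) (auto simp: field_simps)
  then have "long_density x < half_count"
    unfolding assms(1)[symmetric] using pos less12 less23 by (intro divide_strict_right_mono) auto
  then have "eventually (\<lambda>n. real (card {z \<in> Z n. x * real n \<le> real (fact_length z)}) < real (card (Z n)) / 2) sequentially"
    using assms by (intro eventually_less_of_ratio_limits[OF long_asymp half_asymp]) auto
  then show ?thesis
  proof eventually_elim
    case (elim n)
    have "card {z \<in> Z n. x * real n < real (fact_length z)} \<le> card {z \<in> Z n. x * real n \<le> real (fact_length z)}"
      using finite_Z by (intro card_mono) auto
    then show ?case using elim by (intro median_length_le) linarith
  qed
qed

text \<open>Below \<open>L\<close> more than half have length at least \<open>x * n\<close>, so the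
  shorter ones are a minority.\<close>

lemma median_ge_of_long:
  assumes "long_density L = half_count" "1 / real n2 \<le> x" "x < L" "L < 1 / real n1"
  shows "eventually (\<lambda>n. x * real n \<le> median_length n1 n2 n3 n) sequentially"
proof -
  have "(1 - L * real n1)\<^sup>2 < (1 - x * real n1)\<^sup>2"
    using assms pos by (intro power_strict_mono) (auto simp: field_simps)
  then have "half_count < long_density x"
    unfolding assms(1)[symmetric] using pos less12 less23 by (intro divide_strict_right_mono) auto
  then have "eventually (\<lambda>n. real (card (Z n)) / 2 < real (card {z \<in> Z n. x * real n \<le> real (fact_length z)})) sequentially"
    using assms by (intro eventually_less_of_ratio_limits[OF half_asymp long_asymp]) auto
  then show ?thesis
  proof eventually_elim
    case (elim n)
    then show ?case
      using card_split[of n "\<lambda>z. x * real n \<le> real (fact_length z)"]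
      by (intro median_length_ge) (simp add: not_le)
  qed
qed

text \<open>\<open>short_density\<close> increases from \<open>1 / n3\<close> on, so below
  \<open>L\<close> fewer than half are that short.\<close>

lemma median_ge_of_short:
  assumes "short_density L = half_count" "L \<le> 1 / real n2" "x < L" "1 / real n3 < x"
  shows "eventually (\<lambda>n. x * real n \<le> median_length n1 n2 n3 n) sequentially"
proof -
  have "(x * real n3 - 1)\<^sup>2 < (L * real n3 - 1)\<^sup>2"
    using assms less23 by (intro power_strict_mono) (auto simp: field_simps)
  then have "short_density x < half_count"
    unfolding assms(1)[symmetric] using less12 less23 by (intro divide_strict_right_mono) auto
  then have "eventually (\<lambda>n. real (card {z \<in> Z n. real (fact_length z) \<le> x * real n}) < real (card (Z n)) / 2) sequentially"
    using assms by (intro eventually_less_of_ratio_limits[OF short_asymp half_asymp]) auto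
  then show ?thesis
  proof eventually_elim
    case (elim n)
    have "card {z \<in> Z n. real (fact_length z) < x * real n} \<le> card {z \<in> Z n. real (fact_length z) \<le> x * real n}"
      using finite_Z by (intro card_mono) auto
    then show ?case using elim by (intro median_length_ge) linarith
  qed
qed

text \<open>Beyond \<open>L\<close> more than half have length at most \<open>x * n\<close>, so the
  longer ones are a minority.\<close>

lemma median_le_of_short:
  assumes "short_density L = half_count" "x \<le> 1 / real n2" "L < x" "1 / real n3 < L"
  shows "eventually (\<lambda>n. median_length n1 n2 n3 n \<le> x * real n) sequentially"
proof -
  have "(L * real n3 - 1)\<^sup>2 < (x * real n3 - 1)\<^sup>2"
    using assms less23 by (intro power_strict_mono) (auto simp: field_simps)
  then have "half_count < short_density x"
    unfolding assms(1)[symmetric] using less12 less23 by (intro divide_strict_right_mono) auto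
  then have "eventually (\<lambda>n. real (card (Z n)) / 2 < real (card {z \<in> Z n. real (fact_length z) \<le> x * real n})) sequentially"
    using assms by (intro eventually_less_of_ratio_limits[OF half_asymp short_asymp]) auto
  then show ?thesis
  proof eventually_elim
    case (elim n)
    then show ?case
      using card_split[of n "\<lambda>z. real (fact_length z) \<le> x * real n"]
      by (intro median_length_le) (simp add: not_le)
  qed
qed

section \<open>The half-mass point on the unit interval\<close>

text \<open>The affine parametrization carrying \<open>[0, 1]\<close> to the range of the normalized lengths; the
  mode \<open>1 / n2\<close> then sits at the parameter \<open>F\<close>.\<close>

definition mix :: "real \<Rightarrow> real" where
  "mix y = 1 / real n1 * y + 1 / real n3 * (1 - y)"

definition F :: real where
  "F = (real n1 * (real n3 - real n2)) / (real n2 * (real n3 - real n1))"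

lemma mix_less_iff: "mix y < mix z \<longleftrightarrow> y < z"
proof -
  have "mix z - mix y = (1 / real n1 - 1 / real n3) * (z - y)"
    unfolding mix_def by (simp add: algebra_simps diff_divide_distrib)
  moreover have "0 < 1 / real n1 - 1 / real n3"
    using pos less12 less23 by (simp add: field_simps)
  ultimately show ?thesis
    by (metis diff_gt_0_iff_gt zero_less_mult_pos mult_pos_pos)
qed

lemma mix_le_iff: "mix y \<le> mix z \<longleftrightarrow> y \<le> z"
  using mix_less_iff[of z y] by linarith

lemma mix_endpoints: "mix 0 = 1 / real n3" "mix 1 = 1 / real n1" "mix F = 1 / real n2"
proof -
  have ne: "real n1 \<noteq> 0" "real n2 \<noteq> 0" "real n3 \<noteq> 0" "real n3 - real n1 \<noteq> 0"
    using pos less12 less23 by auto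
  show "mix 0 = 1 / real n3" "mix 1 = 1 / real n1" unfolding mix_def by simp_all
  have "real n1 * real n3 * mix F = real n3 * F + real n1 * (1 - F)"
    unfolding mix_def using ne by (simp add: field_simps)
  also have "\<dots> = real n1 + F * (real n3 - real n1)" by (simp add: algebra_simps)
  also have "F * (real n3 - real n1) = real n1 * (real n3 - real n2) / real n2"
    unfolding F_def using ne by simp
  also have "real n1 + \<dots> = real n1 * real n3 / real n2"
    using ne by (simp add: field_simps)
  finally show "mix F = 1 / real n2" using ne by (simp add: field_simps)
qed

lemma F_bounds: "0 < F" "F < 1"
  using mix_less_iff[of 0 F] mix_less_iff[of F 1] pos less12 less23
  unfolding mix_endpoints by (simp_all add: frac_less2)

text \<open>Right of its mode \<open>F\<close>, the triangular law on \<open>[0, 1]\<close> has mass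
  \<open>w^2 / (1 - F)\<close> above \<open>1 - w\<close>; the hypothesis sets this to one
  half.\<close>

lemma long_density_mix:
  assumes "w\<^sup>2 = (1 - F) / 2"
  shows "long_density (mix (1 - w)) = half_count"
proof -
  have ne: "real n1 \<noteq> 0" "real n2 \<noteq> 0" "real n3 \<noteq> 0" "real n3 - real n1 \<noteq> 0" "real n2 - real n1 \<noteq> 0"
    using pos less12 less23 by auto
  have F: "1 - F = real n3 * (real n2 - real n1) / (real n2 * (real n3 - real n1))"
    unfolding F_def using ne by (simp add: divide_simps) (simp add: algebra_simps)
  have "1 - mix (1 - w) * real n1 = w * ((real n3 - real n1) / real n3)"
    unfolding mix_def using ne by (simp add: field_simps)
  then have "(1 - mix (1 - w) * real n1)\<^sup>2 = (1 - F) / 2 * ((real n3 - real n1) / real n3)\<^sup>2"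
    by (simp only: power_mult_distrib assms)
  also have "\<dots> = (real n2 - real n1) * (real n3 - real n1) / (2 * real n2 * real n3)"
    unfolding F using ne by (simp add: power2_eq_square)
  finally have sq: "(1 - mix (1 - w) * real n1)\<^sup>2 =
    (real n2 - real n1) * (real n3 - real n1) / (2 * real n2 * real n3)" .
  \<comment> \<open>The differences of generators are abstracted so that they cancel as single
    factors.\<close>
  have "D * E / (2 * real n2 * real n3) / (2 * D * E * real n1) = half_count"
    if "D \<noteq> 0" "E \<noteq> 0" for D E :: real
    using that by simp
  from this[OF ne(5,4)] show ?thesis unfolding sq .
qed

text \<open>Left of the mode, the mass below \<open>y\<close> is \<open>y^2 / F\<close>.\<close>

lemma short_density_mix:
  assumes "y\<^sup>2 = F / 2"
  shows "short_density (mix y) = half_count"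
proof -
  have ne: "real n1 \<noteq> 0" "real n2 \<noteq> 0" "real n3 \<noteq> 0" "real n3 - real n1 \<noteq> 0" "real n3 - real n2 \<noteq> 0"
    using pos less12 less23 by auto
  have "mix y * real n3 - 1 = y * ((real n3 - real n1) / real n1)"
    unfolding mix_def using ne by (simp add: field_simps)
  then have "(mix y * real n3 - 1)\<^sup>2 = F / 2 * ((real n3 - real n1) / real n1)\<^sup>2"
    by (simp only: power_mult_distrib assms)
  also have "\<dots> = (real n3 - real n2) * (real n3 - real n1) / (2 * real n2 * real n1)"
    unfolding F_def using ne by (simp add: power2_eq_square)
  finally have sq: "(mix y * real n3 - 1)\<^sup>2 =
    (real n3 - real n2) * (real n3 - real n1) / (2 * real n2 * real n1)" .
  have "D * E / (2 * real n2 * real n1) / (2 * E * D * real n3) = half_count"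
    if "D \<noteq> 0" "E \<noteq> 0" for D E :: real
    using that by simp
  from this[OF ne(5,4)] show ?thesis unfolding sq .
qed

section \<open>The limit of the median\<close>

text \<open>At least half of the mass, namely \<open>1 - F\<close>, lies above the mode, so the
  median is at or above it.\<close>

lemma median_limit_le_half:
  assumes "F \<le> 1 / 2"
  shows "(\<lambda>n. median_length n1 n2 n3 n / real n) \<longlonglongrightarrow> mix (1 - sqrt ((1 - F) / 2))"
proof -
  define w where "w = sqrt ((1 - F) / 2)"
  have w2: "w\<^sup>2 = (1 - F) / 2" and w0: "0 < w" unfolding w_def using F_bounds by auto
  note long = long_density_mix[OF w2]
  have half: "w = 1 / 2" if "F = 1 / 2"
    unfolding w_def that by (simp add: real_sqrt_divide)
  have wF: "F < 1 - w" if "F < 1 / 2"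
  proof -
    \<comment> \<open>Squaring turns \<open>w < 1 - F\<close> into
      \<open>(1 - F) / 2 < (1 - F)^2\<close>, that is, \<open>1 / 2 < 1 - F\<close>.\<close>
    have "(1 - F) * (1 / 2) < (1 - F) * (1 - F)"
      using that F_bounds by (intro mult_strict_left_mono) auto
    then have "w\<^sup>2 < (1 - F)\<^sup>2" unfolding w2 by (simp add: power2_eq_square)
    then have "w < 1 - F" using F_bounds by (simp add: power2_less_imp_less)
    then show ?thesis by simp
  qed
  have L: "1 / real n2 \<le> mix (1 - w)" "mix (1 - w) < 1 / real n1"
    unfolding mix_endpoints[symmetric] mix_le_iff mix_less_iff
    using wF half w0 assms by fastforce+
  have hi: "eventually (\<lambda>n. median_length n1 n2 n3 n \<le> x * real n) sequentially"
    if "mix (1 - w) < x" "x < 1 / real n1" for x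
    using median_le_of_long[OF long L(1)] that by blast
  show ?thesis
  proof (cases "F = 1 / 2")
    case True
    \<comment> \<open>The candidate is the mode itself, so the lower bound must come from the short
      counts and the upper one from the long counts.\<close>
    have F: "mix (1 - w) = mix F" unfolding half[OF True] True by simp
    have "short_density (mix F) = half_count"
      using True by (intro short_density_mix) (simp add: power2_eq_square)
    then have short: "short_density (mix (1 - w)) = half_count" unfolding F .
    show ?thesis unfolding w_def[symmetric]
      using F L F_bounds median_ge_of_short[OF short] hi
      by (intro tendsto_ratio_of_linear_bounds[of "1 / real n3" _ "1 / real n1"])
        (auto simp: mix_endpoints(1)[symmetric] mix_less_iff simp flip: mix_endpoints(3))
  next
    case False
    then have "1 / real n2 < mix (1 - w)"
      using wF assms unfolding mix_endpoints[symmetric] mix_less_iff by simp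
    then show ?thesis unfolding w_def[symmetric]
      using L median_ge_of_long[OF long] hi
      by (intro tendsto_ratio_of_linear_bounds[of "1 / real n2" _ "1 / real n1"]) auto
  qed
qed

lemma median_limit_ge_half:
  assumes "1 / 2 \<le> F"
  shows "(\<lambda>n. median_length n1 n2 n3 n / real n) \<longlonglongrightarrow> mix (sqrt (F / 2))"
proof (cases "F = 1 / 2")
  case True
  \<comment> \<open>Both square roots equal \<open>1 / 2\<close> here, so the two formulas
    agree.\<close>
  then have eq: "1 - sqrt ((1 - F) / 2) = sqrt (F / 2)" unfolding True by (simp add: real_sqrt_divide)
  show ?thesis using median_limit_le_half[OF eq_refl[OF True]] unfolding eq .
next
  case False
  define y where "y = sqrt (F / 2)"
  have y2: "y\<^sup>2 = F / 2" and y0: "0 < y" unfolding y_def using F_bounds by auto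
  note short = short_density_mix[OF y2]
  \<comment> \<open>This puts the candidate strictly below the mode, where the short counts give
    both bounds.\<close>
  have "F * (1 / 2) < F * F"
    using False assms F_bounds by (intro mult_strict_left_mono) auto
  then have "y\<^sup>2 < F\<^sup>2" unfolding y2 by (simp add: power2_eq_square)
  then have "y < F" using F_bounds by (simp add: power2_less_imp_less)
  then have L: "1 / real n3 < mix y" "mix y < 1 / real n2"
    unfolding mix_endpoints[symmetric] mix_less_iff using y0 by auto
  then show ?thesis unfolding y_def[symmetric]
    using median_ge_of_short[OF short] median_le_of_short[OF short]
    by (intro tendsto_ratio_of_linear_bounds[of "1 / real n3" _ "1 / real n2"]) auto
qed

end

theorem theorem10:
  fixes n1 n2 n3 :: nat and F :: real
  assumes "0 < n1" and "n1 < n2" and "n2 < n3"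
    and "Gcd {n1, n2, n3} = 1"
    and "F = (real n1 * (real n3 - real n2)) / (real n2 * (real n3 - real n1))"
  shows "(F \<le> 1 / 2 \<longrightarrow>
      ((\<lambda>n. median_length n1 n2 n3 n / real n) \<longlongrightarrow>
         1 / real n1 * (1 - sqrt ((1 - F) / 2)) + 1 / real n3 * sqrt ((1 - F) / 2))
        (inf sequentially (principal (semigroup3 n1 n2 n3)))) \<and>
    (F \<ge> 1 / 2 \<longrightarrow>
      ((\<lambda>n. median_length n1 n2 n3 n / real n) \<longlongrightarrow>
         1 / real n1 * sqrt (F / 2) + 1 / real n3 * (1 - sqrt (F / 2)))
        (inf sequentially (principal (semigroup3 n1 n2 n3))))"
proof -
  interpret three_generators n1 n2 n3
    using assms(1-4) by unfold_locales
  have F: "F = three_generators.F n1 n2 n3"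
    unfolding assms(5) F_def ..
  \<comment> \<open>The limits along \<open>sequentially\<close> pass to the finer filter on the
    semigroup.\<close>
  show ?thesis
    unfolding F
    using tendsto_mono[OF inf_le1 median_limit_le_half] tendsto_mono[OF inf_le1 median_limit_ge_half]
    by (auto simp: mix_def)
qed

end
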